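(* Let $q$ be an odd prime power, $n=2t$ with $t\geq 5$, let $\sigma,\theta$ be any generators of $\mathrm{Gal}(\mathbb{F}_{q^n}/\mathbb{F}_q)$, let $h\in\mathbb{F}_{q^n}$ be any element with $\sigma^t(h)h=-1$, and let $\eta\in\mathbb{F}_{q^n}$ be any element with $\mathrm{N}_{q^n/q}(\eta)\neq 1$. Let $$\mathcal{H}_{\eta,\theta}=\mathcal{H}_{2,\theta}(\eta,0)=\{a_0x+a_1x^{\theta}+a_0\eta x^{\theta^2}: a_0,a_1\in\mathbb{F}_{q^n}\}$$ be the corresponding $2$-dimensional $\mathbb{F}_{q^n}$-linear twisted Gabidulin code. Then $\mathcal{H}_{\eta,\theta}$ is not equivalent to $\mathcal{C}_{h,t,\sigma}$.
   Context: $\mathrm{N}_{q^n/q}$ is the norm from $\mathbb{F}_{q^n}$ to $\mathbb{F}_q$. (For the $k$-dimensional twisted Gabidulin codes the admissibility condition on $\eta$ is $\mathrm{N}_{q^n/q}(\eta)\neq(-1)^{nk}$, which for $k=2$ reads $\mathrm{N}_{q^n/q}(\eta)\neq1$.) For a generator $\sigma$ of $\mathrm{Gal}(\mathbb{F}_{q^n}/\mathbb{F}_q)$, $\mathcal{L}_{n,q}$ denotes the ring (under addition and composition) of $\sigma$-polynomials $f(x)=\sum_{i=0}^{n-1}f_ix^{\sigma^i}$, $f_i\in\mathbb{F}_{q^n}$, each identified with the $\mathbb{F}_q$-endomorphism $\alpha\mapsto\sum_i f_i\sigma^i(\alpha)$ of $\mathbb{F}_{q^n}$; thus $\mathcal{L}_{n,q}\cong\mathrm{End}_{\mathbb{F}_q}(\mathbb{F}_{q^n})$,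 independently of $\sigma$. $\langle\cdot\rangle_{\mathbb{F}_{q^n}}$ denotes the span with respect to left multiplication by scalars of $\mathbb{F}_{q^n}$. A rank-metric code is a subset of $\mathcal{L}_{n,q}$. Two rank-metric codes $\mathcal{C}_1,\mathcal{C}_2\subseteq\mathcal{L}_{n,q}$ are equivalent if there exist invertible $f_1,f_2\in\mathcal{L}_{n,q}$ and a field automorphism $\rho\in\mathrm{Aut}(\mathbb{F}_{q^n})$ with $\mathcal{C}_1=\{f_1\circ g^{\rho}\circ f_2: g\in\mathcal{C}_2\}$, where $g^{\rho}(x)=\sum_i\rho(a_i)x^{\sigma^i}$ if $g(x)=\sum_i a_ix^{\sigma^i}$. $\mathcal{C}_{h,t,\sigma}=\langle x,\psi_{h,t,\sigma}(x)\rangle_{\mathbb{F}_{q^n}}$, where $\psi_{h,t,\sigma}(x)=x^{\sigma}+x^{\sigma^{t-1}}+h\sigma(h)x^{\sigma^{t+1}}+h\sigma^{-1}(h^{-1})x^{\sigma^{2t-1}}$. *)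

theory Defs
  imports
    "HOL-Library.Cardinality"
    "HOL-Library.Function_Algebras"
    "HOL-Number_Theory.Prime_Powers"
begin

text \<open>The ambient field of order \<open>q ^ n\<close> is a finite type \<open>'a\<close> of class \<open>field\<close>; its subfield of
  order \<open>q\<close> is a set \<open>K\<close>.\<close>

definition is_subfield :: "'a::field set \<Rightarrow> bool" where
  "is_subfield K \<longleftrightarrow> 0 \<in> K \<and> 1 \<in> K \<and>
     (\<forall>x\<in>K. \<forall>y\<in>K. x + y \<in> K \<and> x * y \<in> K) \<and> (\<forall>x\<in>K. - x \<in> K \<and> inverse x \<in> K)"

definition field_Aut :: "('a::field \<Rightarrow> 'a) set" where
  "field_Aut = {\<rho>. bij \<rho> \<and> \<rho> 1 = 1 \<and>
     (\<forall>x y. \<rho> (x + y) = \<rho> x + \<rho> y) \<and> (\<forall>x y. \<rho> (x * y) = \<rho> x * \<rho> y)}"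

definition Gal :: "'a::field set \<Rightarrow> ('a \<Rightarrow> 'a) set" where
  "Gal K = {\<tau> \<in> field_Aut. \<forall>x\<in>K. \<tau> x = x}"

text \<open>Natural exponents suffice, since the Galois groups considered are finite.\<close>

definition Gal_generator :: "'a::field set \<Rightarrow> ('a \<Rightarrow> 'a) \<Rightarrow> bool" where
  "Gal_generator K \<sigma> \<longleftrightarrow> \<sigma> \<in> Gal K \<and> (\<forall>\<tau>\<in>Gal K. \<exists>i::nat. \<tau> = \<sigma> ^^ i)"

definition field_norm :: "'a::field set \<Rightarrow> 'a \<Rightarrow> 'a" where
  "field_norm K x = (\<Prod>\<tau>\<in>Gal K. \<tau> x)"

text \<open>A \<open>\<sigma>\<close>-polynomial with coefficients \<open>c 0, \<dots>, c (n - 1)\<close> is represented by the map it induces.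
  When \<open>\<sigma>\<close> generates a Galois group of order \<open>n\<close>, the powers \<open>\<sigma> ^^ i\<close> with \<open>i < n\<close> are linearly
  independent, so the map determines these coefficients.\<close>

definition sigma_poly :: "nat \<Rightarrow> ('a::field \<Rightarrow> 'a) \<Rightarrow> (nat \<Rightarrow> 'a) \<Rightarrow> 'a \<Rightarrow> 'a" where
  "sigma_poly n \<sigma> c = (\<lambda>x. \<Sum>i<n. c i * (\<sigma> ^^ i) x)"

definition sigma_polys :: "nat \<Rightarrow> ('a::field \<Rightarrow> 'a) \<Rightarrow> ('a \<Rightarrow> 'a) set" where
  "sigma_polys n \<sigma> = range (sigma_poly n \<sigma>)"

definition invertible_sigma_polys :: "nat \<Rightarrow> ('a::field \<Rightarrow> 'a) \<Rightarrow> ('a \<Rightarrow> 'a) set" where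
  "invertible_sigma_polys n \<sigma> =
     {f \<in> sigma_polys n \<sigma>. \<exists>g \<in> sigma_polys n \<sigma>. f \<circ> g = id \<and> g \<circ> f = id}"

text \<open>For \<open>g = sigma_poly n \<sigma> a\<close> the conjugate \<open>g\<^sup>\<rho>\<close> is \<open>sigma_poly n \<sigma> (\<rho> \<circ> a)\<close>.\<close>

definition code_equivalent ::
    "nat \<Rightarrow> ('a::field \<Rightarrow> 'a) \<Rightarrow> ('a \<Rightarrow> 'a) set \<Rightarrow> ('a \<Rightarrow> 'a) set \<Rightarrow> bool" where
  "code_equivalent n \<sigma> C1 C2 \<longleftrightarrow>
     (\<exists>f1 \<in> invertible_sigma_polys n \<sigma>. \<exists>f2 \<in> invertible_sigma_polys n \<sigma>. \<exists>\<rho> \<in> field_Aut.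
        C1 = {f1 \<circ> sigma_poly n \<sigma> (\<rho> \<circ> a) \<circ> f2 | a. sigma_poly n \<sigma> a \<in> C2})"

interpretation left_scalar: vector_space "\<lambda>(c::'a::field) (f::'a \<Rightarrow> 'a) x. c * f x"
  by unfold_locales (auto simp: fun_eq_iff algebra_simps)

definition psi :: "'a::field \<Rightarrow> nat \<Rightarrow> ('a \<Rightarrow> 'a) \<Rightarrow> 'a \<Rightarrow> 'a" where
  "psi h t \<sigma> = (\<lambda>x. \<sigma> x + (\<sigma> ^^ (t - 1)) x + h * \<sigma> h * (\<sigma> ^^ (t + 1)) x
                     + h * inv \<sigma> (inverse h) * (\<sigma> ^^ (2 * t - 1)) x)"

definition code_C :: "'a::field \<Rightarrow> nat \<Rightarrow> ('a \<Rightarrow> 'a) \<Rightarrow> ('a \<Rightarrow> 'a) set" where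
  "code_C h t \<sigma> = left_scalar.span {\<lambda>x. x, psi h t \<sigma>}"

definition twisted_Gabidulin_2 :: "'a::field \<Rightarrow> ('a \<Rightarrow> 'a) \<Rightarrow> ('a \<Rightarrow> 'a) set" where
  "twisted_Gabidulin_2 \<eta> \<theta> = {\<lambda>x. a0 * x + a1 * \<theta> x + a0 * \<eta> * (\<theta> ^^ 2) x | a0 a1. True}"

end

theory Submission
  imports Defs "HOL-Number_Theory.Residues" "HOL-Computational_Algebra.Polynomial"
begin

text \<open>
  The left idealiser of the twisted Gabidulin code consists of the scalar maps. An equivalence
  \<open>(f1, f2, \<rho>)\<close> with \<open>code_C h t \<sigma>\<close> conjugates scalars by \<open>f1\<close> into this left idealiser, which makes
  \<open>f1\<close> a scalar multiple of some \<open>\<tau> \<in> Gal K\<close>. Hence \<open>f = f1 \<circ> f2\<close> and some \<open>g \<circ> f\<close> both lie in the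
  twisted Gabidulin code, where \<open>g\<close> is a \<open>\<sigma>\<close>-polynomial with exactly the exponents of \<open>psi h t \<sigma>\<close>,
  namely \<open>\<plusminus>1\<close> and \<open>t \<plusminus> 1\<close> modulo \<open>2 * t\<close>. Writing \<open>\<theta> = \<sigma> ^^ s\<close> with \<open>s\<close> coprime to \<open>2 * t\<close>, the terms of
  \<open>g \<circ> f\<close> have exponents \<open>j + i * s\<close> with \<open>i \<le> 2\<close>; by linear independence of automorphisms, each of
  them must cancel or have exponent \<open>0\<close>, \<open>s\<close> or \<open>2 * s\<close>, and counting modulo \<open>t\<close> shows that for
  \<open>t \<ge> 5\<close> some term does neither.
\<close>

section \<open>Field automorphisms and their iterates\<close>

lemma field_Aut_0: "\<tau> \<in> field_Aut \<Longrightarrow> \<tau> 0 = 0"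
  unfolding field_Aut_def by (metis (mono_tags, lifting) add_cancel_right_left mem_Collect_eq)

lemma field_Aut_1: "\<tau> \<in> field_Aut \<Longrightarrow> \<tau> 1 = 1"
  and field_Aut_add: "\<tau> \<in> field_Aut \<Longrightarrow> \<tau> (x + y) = \<tau> x + \<tau> y"
  and field_Aut_mult: "\<tau> \<in> field_Aut \<Longrightarrow> \<tau> (x * y) = \<tau> x * \<tau> y"
  and field_Aut_bij: "\<tau> \<in> field_Aut \<Longrightarrow> bij \<tau>"
  by (auto simp: field_Aut_def)

lemma field_Aut_eq_0_iff: "\<tau> \<in> field_Aut \<Longrightarrow> \<tau> x = 0 \<longleftrightarrow> x = 0"
  using field_Aut_0[of \<tau>] field_Aut_bij[of \<tau>] by (metis bij_pointE)

lemma field_Aut_sum: "\<tau> \<in> field_Aut \<Longrightarrow> \<tau> (sum f A) = (\<Sum>a\<in>A. \<tau> (f a))"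
  by (induction A rule: infinite_finite_induct) (simp_all add: field_Aut_0 field_Aut_add)

lemma field_Aut_power: "\<tau> \<in> field_Aut \<Longrightarrow> \<tau> (x ^ i) = \<tau> x ^ i"
  by (induction i) (simp_all add: field_Aut_1 field_Aut_mult)

lemma field_Aut_uminus: "\<tau> \<in> field_Aut \<Longrightarrow> \<tau> (- x) = - \<tau> x"
  by (metis add.right_inverse field_Aut_0 field_Aut_add minus_unique)

lemma field_Aut_diff: "\<tau> \<in> field_Aut \<Longrightarrow> \<tau> (x - y) = \<tau> x - \<tau> y"
  by (metis diff_conv_add_uminus field_Aut_add field_Aut_uminus)

lemma funpow_field_Aut: "\<tau> \<in> field_Aut \<Longrightarrow> \<tau> ^^ i \<in> field_Aut"
proof (induction i)
  case (Suc i)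
  then have "bij (\<tau> ^^ Suc i)" by (intro bij_fn field_Aut_bij)
  with Suc show ?case by (simp add: field_Aut_def o_def)
qed (simp add: field_Aut_def id_def flip: id_def)

lemma Gal_imp_field_Aut: "\<tau> \<in> Gal K \<Longrightarrow> \<tau> \<in> field_Aut"
  by (simp add: Gal_def)

lemma Gal_fixes: "\<tau> \<in> Gal K \<Longrightarrow> x \<in> K \<Longrightarrow> \<tau> x = x"
  by (simp add: Gal_def)

lemma funpow_Gal: "\<tau> \<in> Gal K \<Longrightarrow> \<tau> ^^ i \<in> Gal K"
proof -
  assume \<tau>: "\<tau> \<in> Gal K"
  have "(\<tau> ^^ i) x = x" if "x \<in> K" for x
    using \<tau> that by (induction i) (simp_all add: Gal_fixes)
  with \<tau> show ?thesis by (simp add: Gal_def funpow_field_Aut)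
qed

section \<open>The Galois group of a finite field over a subfield\<close>

lemma subfield_power_card_eq_same:
  fixes K :: "'a::{field,finite} set"
  assumes "is_subfield K" "x \<in> K"
  shows "x ^ card K = x"
proof (cases "x = 0")
  case True
  have "card K > 0" using assms by (auto simp: is_subfield_def card_gt_0_iff)
  with True show ?thesis by simp
next
  case False
  have card: "card K = Suc (card (K - {0}))"
    using assms(1) by (metis card.remove finite is_subfield_def)
  \<comment> \<open>Multiplication by \<open>x\<close> permutes the nonzero elements of
    \<open>K\<close>, so their product cancels.\<close>
  have "x ^ card (K - {0}) * \<Prod>(K - {0}) = (\<Prod>y\<in>K - {0}. x * y)"
    by (simp add: prod.distrib)
  also have "\<dots> = (\<Prod>y\<in>K - {0}. y)"
    using assms False
    by (intro prod.reindex_bij_witness[of _ "\<lambda>y. inverse x * y" "\<lambda>y. x * y"])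
      (auto simp: is_subfield_def mult.assoc[symmetric])
  finally have "x ^ card (K - {0}) = 1" by simp
  with card show ?thesis by simp
qed

lemma finite_field_primitive_element:
  obtains g :: "'a::{field,finite}" where "\<And>x. x \<noteq> 0 \<Longrightarrow> \<exists>i::nat. x = g ^ i"
proof -
  define R where "R = \<lparr>carrier = (UNIV :: 'a set), monoid.mult = (*) :: 'a \<Rightarrow> _, one = 1,
    ring.zero = 0, add = (+) :: 'a \<Rightarrow> 'a \<Rightarrow> 'a\<rparr>"
  interpret R: field R
  proof
    show "Units R = carrier R - {\<zero>\<^bsub>R\<^esub>}"
      by (auto simp: R_def Units_def) (metis mult.commute right_inverse)
  qed (auto simp: R_def algebra_simps Units_def intro: exI[of _ "- x" for x])
  have pow: "x [^]\<^bsub>R\<^esub> (i::nat) = x ^ i" for x i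
    by (induction i) (simp_all add: R_def nat_pow_def mult.commute)
  have "finite (carrier R)" by simp
  from R.finite_field_mult_group_has_gen[OF this]
  obtain g where "carrier (mult_of R) = {g [^]\<^bsub>R\<^esub> i | i::nat. i \<in> UNIV}" by blast
  then have "UNIV - {0} = {g ^ i | i::nat. i \<in> UNIV}"
    by (simp add: pow) (simp add: R_def)
  with that show thesis by blast
qed

text \<open>The characteristic divides \<open>q ^ n\<close>, hence is the prime underlying
  \<open>q\<close>, and additivity is the freshman's dream.\<close>

lemma Frobenius_in_Gal:
  fixes K :: "'a::{field,finite} set"
  assumes "primepow q" "is_subfield K" "card K = q" "CARD('a) = q ^ n"
  shows "(\<lambda>x. x ^ q) \<in> Gal K"
proof -
  obtain p k where p: "prime p" "q = p ^ k" using assms(1) by (auto simp: primepow_def)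
  have "CHAR('a) > 0" by (intro finite_imp_CHAR_pos) simp
  then have prime: "prime CHAR('a)" by (rule prime_CHAR_semidom)
  have "CHAR('a) dvd p ^ (k * n)"
    using CHAR_dvd_CARD[where ?'a = 'a] assms(4) p(2) by (simp add: power_mult)
  then have "CHAR('a) = p"
    using prime p(1) prime_dvd_power primes_dvd_imp_eq by blast
  then have add: "(x + y) ^ q = x ^ q + y ^ q" for x y :: 'a
    using prime p(2) freshmans_dream' by blast
  have "q > 0" using assms(1) primepow_gt_0_nat by blast
  have minus: "(x - y) ^ q = x ^ q - y ^ q" for x y :: 'a
    using add[of "x - y" y] by (simp add: algebra_simps)
  have "inj (\<lambda>x::'a. x ^ q)"
  proof (rule injI)
    fix x y :: 'a assume "x ^ q = y ^ q"
    then have "(x - y) ^ q = 0" by (simp add: minus)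
    then show "x = y" by simp
  qed
  then have "bij (\<lambda>x::'a. x ^ q)" by (simp add: bij_betw_def finite_UNIV_inj_surj)
  with assms add show ?thesis
    by (auto simp: Gal_def field_Aut_def power_mult_distrib subfield_power_card_eq_same)
qed

lemma funpow_power: "((\<lambda>x::'a::monoid_mult. x ^ q) ^^ i) x = x ^ q ^ i"
  by (induction i) (simp_all add: power_mult[symmetric] mult.commute)

lemma card_power_eq_self_le:
  assumes "m > 1"
  shows "card {x::'a::field. x ^ m = x} \<le> m"
proof -
  let ?p = "monom 1 m - monom (1::'a) 1"
  have nz: "?p \<noteq> 0"
  proof
    assume "?p = 0"
    then have "coeff ?p m = 0" by simp
    then show False using assms by simp
  qed
  have deg: "degree ?p \<le> m"
    using assms by (intro degree_diff_le) (auto simp: degree_monom_eq)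
  have "{x::'a. x ^ m = x} = {x. poly ?p x = 0}" by (auto simp: poly_monom)
  with card_poly_roots_bound[OF nz] deg show ?thesis by simp
qed

text \<open>With \<open>g\<close> generating the multiplicative group, the polynomial with roots \<open>g ^ q ^ i\<close>, \<open>i < n\<close>, has
  coefficients in \<open>K\<close>, so every element of the Galois group maps \<open>g\<close> to one of these roots.\<close>

lemma Gal_eq_Frobenius_power:
  fixes K :: "'a::{field,finite} set"
  assumes "primepow q" "is_subfield K" "card K = q" "CARD('a) = q ^ n" "n > 0" "\<tau> \<in> Gal K"
  shows "\<exists>i. \<tau> = (\<lambda>x. x ^ q) ^^ i"
proof -
  let ?\<Phi> = "\<lambda>x::'a. x ^ q"
  have \<Phi>: "?\<Phi> \<in> field_Aut"
    using Frobenius_in_Gal[OF assms(1-4)] Gal_imp_field_Aut by blast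
  have q: "q > 1" using assms(1) primepow_gt_Suc_0 by auto
  \<comment> \<open>\<open>K\<close> already supplies \<open>q\<close> roots of
    \<open>X ^ q - X\<close>, so every fixed point of Frobenius lies in \<open>K\<close>. This is
    what will place the coefficients of \<open>P\<close> in \<open>K\<close>.\<close>
  have K: "K = {x. x ^ q = x}"
  proof (rule card_seteq)
    show "K \<subseteq> {x. x ^ q = x}" using subfield_power_card_eq_same assms(2,3) by blast
    show "card {x::'a. x ^ q = x} \<le> card K" using card_power_eq_self_le[OF q] assms(3) by simp
  qed simp
  obtain g :: 'a where g: "\<And>x. x \<noteq> 0 \<Longrightarrow> \<exists>i::nat. x = g ^ i"
    using finite_field_primitive_element by blast
  define P where "P = (\<Prod>i<n. [:- (g ^ q ^ i), 1:])"
  have \<tau>: "\<tau> \<in> field_Aut" using assms(6) by (rule Gal_imp_field_Aut)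
  have "g ^ q ^ n = g"
    using subfield_power_card_eq_same[of UNIV g] assms(4) by (simp add: is_subfield_def)
  \<comment> \<open>Since \<open>g ^ q ^ n = g\<close>, Frobenius permutes the factors
    cyclically.\<close>
  then have shift: "(\<Prod>i<n. y - g ^ q ^ Suc i) = (\<Prod>i<n. y - g ^ q ^ i)" for y
  proof -
    obtain m where m: "n = Suc m" using assms(5) gr0_implies_Suc by blast
    have "(\<Prod>i<n. y - g ^ q ^ Suc i) = (\<Prod>i<m. y - g ^ q ^ Suc i) * (y - g ^ q ^ n)"
      unfolding m by (rule prod.lessThan_Suc)
    also have "\<dots> = (\<Prod>i<n. y - g ^ q ^ i)"
      unfolding \<open>g ^ q ^ n = g\<close> unfolding m by (subst prod.lessThan_Suc_shift) simp
    finally show ?thesis .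
  qed
  have poly_P: "poly P y = (\<Prod>i<n. y - g ^ q ^ i)" for y
    by (simp add: P_def poly_prod)
  have deg: "degree P = n"
    unfolding P_def by (subst degree_prod_eq_sum_degree) auto
  have \<Phi>P: "poly (map_poly ?\<Phi> P) (?\<Phi> y) = ?\<Phi> (poly P y)" for y
  proof -
    have "degree (map_poly ?\<Phi> P) = degree P"
      using q by (intro degree_map_poly) auto
    moreover have "coeff (map_poly ?\<Phi> P) i = ?\<Phi> (coeff P i)" for i
      using q by (intro coeff_map_poly) auto
    ultimately show ?thesis
      by (simp add: poly_altdef field_Aut_sum[OF \<Phi>] power_mult_distrib flip: power_mult)
        (simp add: mult.commute)
  qed
  have "?\<Phi> (poly P y) = poly P (?\<Phi> y)" for y
  proof -
    have "?\<Phi> (poly P y) = (\<Prod>i<n. ?\<Phi> (y - g ^ q ^ i))"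
      by (simp add: poly_P prod_power_distrib)
    also have "\<dots> = (\<Prod>i<n. ?\<Phi> y - g ^ q ^ Suc i)"
      by (intro prod.cong refl) (simp add: field_Aut_diff[OF \<Phi>] mult.commute flip: power_mult)
    finally show ?thesis by (simp only: shift poly_P)
  qed
  then have "poly (map_poly ?\<Phi> P) y = poly P y" for y
    using \<Phi>P field_Aut_bij[OF \<Phi>] by (metis bij_pointE)
  \<comment> \<open>Both polynomials have degree at most \<open>n\<close> and agree on the whole
    field, which has more than \<open>n\<close> points, so their coefficients agree.\<close>
  moreover have "n < CARD('a)" using assms(4) q by (simp add: power_gt_expt)
  moreover have "degree (map_poly ?\<Phi> P) \<le> n" using deg q degree_map_poly[of ?\<Phi> P] by auto
  ultimately have "map_poly ?\<Phi> P = P"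
    using deg by (intro poly_eqI_degree[where A = UNIV]) auto
  then have "?\<Phi> (coeff P i) = coeff P i" for i
    using q coeff_map_poly[of ?\<Phi> P i] by auto
  then have "\<tau> (coeff P i) = coeff P i" for i
    using K Gal_fixes[OF assms(6)] by blast
  then have "poly P (\<tau> g) = \<tau> (poly P g)"
    by (simp add: poly_altdef field_Aut_sum[OF \<tau>] field_Aut_mult[OF \<tau>] field_Aut_power[OF \<tau>])
  also have "poly P g = 0" using assms(5) by (auto simp: poly_P intro!: bexI[of _ 0])
  finally obtain i where i: "\<tau> g = g ^ q ^ i"
    by (auto simp: poly_P field_Aut_0[OF \<tau>])
  have "\<tau> x = (?\<Phi> ^^ i) x" for x
  proof (cases "x = 0")
    case True
    then show ?thesis using q field_Aut_0[OF \<tau>] by (simp add: funpow_power)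
  next
    case False
    then obtain j where "x = g ^ j" using g by blast
    then show ?thesis
      by (simp add: funpow_power field_Aut_power[OF \<tau>] i mult.commute flip: power_mult)
  qed
  then show ?thesis by blast
qed

text \<open>\<open>\<sigma>\<close> and Frobenius are powers of one another, so triviality of a
  power passes between them. If the \<open>r\<close>-th power were trivial with
  \<open>0 < r < n\<close>, all \<open>q ^ n\<close> elements would be roots of
  \<open>X ^ (q ^ r) - X\<close>.\<close>

lemma
  fixes K :: "'a::{field,finite} set"
  assumes "primepow q" "is_subfield K" "card K = q" "CARD('a) = q ^ n" "n > 0"
    and \<sigma>: "Gal_generator K \<sigma>"
  shows Gal_generator_funpow_id: "\<sigma> ^^ n = id"
    and Gal_generator_funpow_eq_idD: "\<sigma> ^^ m = id \<Longrightarrow> n dvd m"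
proof -
  let ?\<Phi> = "\<lambda>x::'a. x ^ q"
  have q: "q > 1" using assms(1) primepow_gt_Suc_0 by auto
  have \<sigma>': "\<sigma> \<in> Gal K" using \<sigma> by (simp add: Gal_generator_def)
  obtain i where i: "\<sigma> = ?\<Phi> ^^ i" using Gal_eq_Frobenius_power[OF assms(1-5) \<sigma>'] by blast
  have "(?\<Phi> ^^ n) x = x" for x
    using subfield_power_card_eq_same[of UNIV x] assms(4) by (simp add: is_subfield_def funpow_power)
  then have "?\<Phi> ^^ n = id" by auto
  then show id: "\<sigma> ^^ n = id"
    by (metis i funpow_mult mult.commute id_funpow)
  obtain j where j: "?\<Phi> = \<sigma> ^^ j"
    using \<sigma> Frobenius_in_Gal[OF assms(1-4)] by (auto simp: Gal_generator_def)
  show "n dvd m" if m: "\<sigma> ^^ m = id"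
  proof (rule ccontr)
    assume "\<not> n dvd m"
    define r where "r = m mod n"
    have r: "0 < r" "r < n" using \<open>\<not> n dvd m\<close> assms(5) by (auto simp: r_def dvd_eq_mod_eq_0)
    have "\<sigma> ^^ r = id" using m id by (auto simp: r_def funpow_mod_eq fun_eq_iff)
    then have "?\<Phi> ^^ r = id" using j by (metis funpow_mult mult.commute id_funpow)
    then have "x ^ (q ^ r) = x" for x :: 'a by (simp add: fun_eq_iff funpow_power)
    then have "CARD('a) \<le> q ^ r"
      using card_power_eq_self_le[of "q ^ r", where ?'a = 'a] one_less_power[of q r] q r by simp
    with assms(4) q r show False by simp
  qed
qed

section \<open>Linear independence of automorphisms\<close>

text \<open>Dedekind's argument: evaluating the relation at \<open>y * x\<close> and subtracting
  \<open>\<tau>0 y\<close> times the original eliminates \<open>\<tau>0\<close> and scales the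
  coefficient of \<open>\<tau>\<close> by \<open>\<tau> y - \<tau>0 y\<close>, which is nonzero for
  a suitable \<open>y\<close>.\<close>

lemma field_Aut_independent:
  assumes "finite S" "S \<subseteq> field_Aut" "\<And>x. (\<Sum>\<tau>\<in>S. c \<tau> * \<tau> x) = 0" "\<tau> \<in> S"
  shows "c \<tau> = (0::'a::field)"
  using assms
proof (induction S arbitrary: c \<tau>)
  case (insert \<tau>0 S)
  have \<tau>0: "\<tau>0 \<in> field_Aut" using insert.prems by auto
  have c: "c \<tau> = 0" if "\<tau> \<in> S" for \<tau>
  proof -
    have "\<tau> \<noteq> \<tau>0" using that insert.hyps by auto
    then obtain y where y: "\<tau> y \<noteq> \<tau>0 y" by blast
    have "(\<Sum>\<tau>\<in>S. (c \<tau> * (\<tau> y - \<tau>0 y)) * \<tau> x) = 0" for x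
    proof -
      have "(\<Sum>\<tau>\<in>S. (c \<tau> * (\<tau> y - \<tau>0 y)) * \<tau> x)
          = (\<Sum>\<tau>\<in>insert \<tau>0 S. (c \<tau> * (\<tau> y - \<tau>0 y)) * \<tau> x)"
        using insert.hyps by simp
      also have "\<dots> = (\<Sum>\<tau>\<in>insert \<tau>0 S. c \<tau> * \<tau> (y * x) - \<tau>0 y * (c \<tau> * \<tau> x))"
        using insert.prems(1) by (intro sum.cong refl) (auto simp: field_Aut_mult algebra_simps)
      also have "\<dots> = 0"
        by (simp only: sum_subtractf sum_distrib_left[symmetric] insert.prems(2)) simp
      finally show ?thesis .
    qed
    then have "c \<tau> * (\<tau> y - \<tau>0 y) = 0"
      using insert.prems(1) that insert.IH[of "\<lambda>\<tau>. c \<tau> * (\<tau> y - \<tau>0 y)" \<tau>] by simp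
    with y show ?thesis by simp
  qed
  have "(\<Sum>\<tau>\<in>S. c \<tau> * \<tau> 1) = 0" by (rule sum.neutral) (simp add: c)
  then have "c \<tau>0 = 0"
    using insert.prems(2)[of 1] insert.hyps by (simp add: field_Aut_1[OF \<tau>0])
  with c[of \<tau>] insert.prems(3) show ?case by (metis insertE)
qed simp

text \<open>Here an automorphism may occur under several indices. Independence makes the
  coefficients over each automorphism sum to zero, so a nonzero term never stands alone.\<close>

lemma field_Aut_sum_eq_0_collision:
  assumes "finite A" "\<And>a. a \<in> A \<Longrightarrow> T a \<in> field_Aut"
    and "\<And>x. (\<Sum>a\<in>A. d a * T a x) = 0" "a0 \<in> A" "d a0 \<noteq> (0::'a::field)"
  obtains a where "a \<in> A" "a \<noteq> a0" "T a = T a0" "d a \<noteq> 0"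
proof -
  have "(\<Sum>\<tau>\<in>T ` A. (\<Sum>a\<in>{a \<in> A. T a = \<tau>}. d a) * \<tau> x) = 0" for x
  proof -
    have "(\<Sum>\<tau>\<in>T ` A. (\<Sum>a\<in>{a \<in> A. T a = \<tau>}. d a) * \<tau> x)
        = (\<Sum>\<tau>\<in>T ` A. \<Sum>a\<in>{a \<in> A. T a = \<tau>}. d a * T a x)"
      by (simp add: sum_distrib_right)
    also have "\<dots> = (\<Sum>a\<in>A. d a * T a x)"
      using assms(1) by (intro sum.group) auto
    finally show ?thesis using assms(3) by simp
  qed
  then have "(\<Sum>a\<in>{a \<in> A. T a = T a0}. d a) = 0"
    using assms(1,2,4) field_Aut_independent[of "T ` A" "\<lambda>\<tau>. \<Sum>a\<in>{a \<in> A. T a = \<tau>}. d a" "T a0"]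
    by auto
  moreover have "(\<Sum>a\<in>{a \<in> A. T a = T a0}. d a) = d a0"
    if "\<And>a. a \<in> A \<Longrightarrow> a \<noteq> a0 \<Longrightarrow> T a = T a0 \<Longrightarrow> d a = 0"
    using that assms(1,4) by (subst sum.remove[of _ a0]) auto
  ultimately show thesis using that assms(5) by metis
qed

section \<open>Sigma-polynomials and the left idealiser of the twisted Gabidulin code\<close>

lemma sigma_poly_coeff_unique:
  assumes \<sigma>: "\<sigma> \<in> field_Aut" and inj: "inj_on (\<lambda>i. \<sigma> ^^ i) {..<n}"
    and eq: "sigma_poly n \<sigma> c = sigma_poly n \<sigma> c'" and "i < n"
  shows "c i = c' i"
proof (rule ccontr)
  assume "c i \<noteq> c' i"
  have sum0: "(\<Sum>i<n. (c i - c' i) * (\<sigma> ^^ i) x) = 0" for x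
    using fun_cong[OF eq, of x] by (simp add: sigma_poly_def left_diff_distrib sum_subtractf)
  obtain j where "j \<in> {..<n}" "j \<noteq> i" "\<sigma> ^^ j = \<sigma> ^^ i"
    by (rule field_Aut_sum_eq_0_collision[where T = "\<lambda>i. \<sigma> ^^ i" and ?a0.0 = i, OF _ _ sum0])
      (use \<open>i < n\<close> \<open>c i \<noteq> c' i\<close> in \<open>simp_all add: funpow_field_Aut[OF \<sigma>]\<close>)
  with inj \<open>i < n\<close> show False by (auto dest: inj_onD)
qed

text \<open>Reduce the exponents modulo \<open>n\<close> and collect equal ones. Composites, scalars
  and polynomials in a power of an automorphism are all handled through this form.\<close>

lemma sum_funpow_in_sigma_polys:
  assumes "finite A" "\<sigma> ^^ n = id" "n > 0"
  shows "(\<lambda>x. \<Sum>a\<in>A. d a * (\<sigma> ^^ e a) x) \<in> sigma_polys n \<sigma>"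
proof -
  have "(\<Sum>a\<in>A. d a * (\<sigma> ^^ e a) x)
      = sigma_poly n \<sigma> (\<lambda>i. \<Sum>a\<in>{a \<in> A. e a mod n = i}. d a) x" for x
  proof -
    have "(\<Sum>a\<in>A. d a * (\<sigma> ^^ e a) x) = (\<Sum>a\<in>A. d a * (\<sigma> ^^ (e a mod n)) x)"
      using assms(2) by (simp add: funpow_mod_eq)
    also have "\<dots> = (\<Sum>i<n. \<Sum>a\<in>{a \<in> A. e a mod n = i}. d a * (\<sigma> ^^ (e a mod n)) x)"
      using assms by (intro sum.group[symmetric]) auto
    also have "\<dots> = sigma_poly n \<sigma> (\<lambda>i. \<Sum>a\<in>{a \<in> A. e a mod n = i}. d a) x"
      by (simp add: sigma_poly_def sum_distrib_right)
    finally show ?thesis .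
  qed
  then show ?thesis by (auto simp: sigma_polys_def fun_eq_iff)
qed

lemma sigma_polys_comp:
  assumes "f \<in> sigma_polys n \<sigma>" "g \<in> sigma_polys n \<sigma>" "\<sigma> \<in> field_Aut" "\<sigma> ^^ n = id" "n > 0"
  shows "f \<circ> g \<in> sigma_polys n \<sigma>"
proof -
  obtain c c' where c: "f = sigma_poly n \<sigma> c" "g = sigma_poly n \<sigma> c'"
    using assms(1,2) by (auto simp: sigma_polys_def)
  have "f \<circ> g = (\<lambda>x. \<Sum>(i, j)\<in>{..<n} \<times> {..<n}. c i * (\<sigma> ^^ i) (c' j) * (\<sigma> ^^ (i + j)) x)"
    by (simp add: c sigma_poly_def o_def field_Aut_sum funpow_field_Aut assms(3) field_Aut_mult
        sum_distrib_left funpow_add mult.assoc flip: sum.cartesian_product)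
  also have "\<dots> \<in> sigma_polys n \<sigma>"
    using sum_funpow_in_sigma_polys[where A = "{..<n} \<times> {..<n}" and \<sigma> = \<sigma> and n = n
        and d = "\<lambda>(i, j). c i * (\<sigma> ^^ i) (c' j)" and e = "\<lambda>(i, j). i + j"] assms by (simp add: case_prod_unfold)
  finally show ?thesis .
qed

lemma scale_in_sigma_polys:
  assumes "\<sigma> ^^ n = id" "n > 0"
  shows "(\<lambda>x. \<alpha> * x) \<in> sigma_polys n \<sigma>"
  using sum_funpow_in_sigma_polys[where A = "{0::nat}" and \<sigma> = \<sigma> and n = n and d = "\<lambda>_. \<alpha>" and e = "\<lambda>_. 0"] assms by simp

text \<open>Serves to read a map built from \<open>\<sigma>\<close> as a polynomial in
  \<open>\<theta>\<close>, the automorphism that defines the twisted Gabidulin code.\<close>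

lemma sigma_polys_funpow_subset:
  assumes "\<theta> ^^ n = id" "n > 0"
  shows "sigma_polys n (\<theta> ^^ r) \<subseteq> sigma_polys n \<theta>"
proof
  fix f assume "f \<in> sigma_polys n (\<theta> ^^ r)"
  then obtain c where "f = sigma_poly n (\<theta> ^^ r) c" by (auto simp: sigma_polys_def)
  then have "f = (\<lambda>x. \<Sum>i<n. c i * (\<theta> ^^ (i * r)) x)"
    by (simp add: sigma_poly_def funpow_mult mult.commute)
  then show "f \<in> sigma_polys n \<theta>"
    using sum_funpow_in_sigma_polys[where A = "{..<n}" and \<sigma> = \<theta> and n = n and d = c and e = "\<lambda>i. i * r"] assms by simp
qed

text \<open>Composing with \<open>\<alpha> * \<theta> x\<close> for all \<open>\<alpha>\<close> restricts \<open>\<phi>\<close> to the exponents \<open>-1\<close>, \<open>0\<close>, \<open>1\<close>; letting \<open>\<alpha>\<close> vary,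
  independence of \<open>\<theta>\<close> and \<open>inv \<theta>\<close> kills the exponents \<open>\<plusminus>1\<close>, up to the Gabidulin case \<open>\<eta> = 0\<close>.\<close>

lemma sigma_polys_left_idealiser_twisted_Gabidulin:
  assumes \<theta>: "\<theta> \<in> field_Aut" "\<theta> ^^ n = id" and inj: "inj_on (\<lambda>i. \<theta> ^^ i) {..<n}" and n: "n > 2"
    and \<phi>: "\<phi> \<in> sigma_polys n \<theta>"
    and H: "\<And>g. g \<in> twisted_Gabidulin_2 \<eta> \<theta> \<Longrightarrow> \<phi> \<circ> g \<in> twisted_Gabidulin_2 \<eta> \<theta>"
  shows "\<exists>b. \<forall>x. \<phi> x = b * x"
proof -
  obtain c where c: "\<phi> = sigma_poly n \<theta> c" using \<phi> by (auto simp: sigma_polys_def)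
  have n1: "n - 1 \<noteq> 0" "n - 1 \<noteq> 1" "n - Suc 0 \<noteq> Suc 0" using n by auto
  \<comment> \<open>Coefficient families supported on \<open>0\<close>, \<open>1\<close> and
    \<open>n - 1\<close>, the last standing for the exponent -1; \<open>n > 2\<close> keeps the
    three apart.\<close>
  define C where "C u v w = (\<lambda>i. if i = 0 then u else if i = 1 then v else if i = n - 1 then w else 0)" for u v w :: 'a
  have C: "C u v w 0 = u" "C u v w 1 = v" "C u v w (n - 1) = w"
    "i \<noteq> 0 \<Longrightarrow> i \<noteq> 1 \<Longrightarrow> i \<noteq> n - 1 \<Longrightarrow> C u v w i = 0" for u v w i
    using n1 by (simp_all add: C_def)
  have sparse: "sigma_poly n \<theta> (C u v w)
      = (\<lambda>x. u * x + v * \<theta> x + w * (\<theta> ^^ (n - 1)) x)" for u v w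
  proof
    fix x
    have "sigma_poly n \<theta> (C u v w) x = (\<Sum>i\<in>{0, 1, n - 1}. C u v w i * (\<theta> ^^ i) x)"
      unfolding sigma_poly_def using n by (intro sum.mono_neutral_right) (auto simp: C_def)
    also have "\<dots> = u * x + v * \<theta> x + w * (\<theta> ^^ (n - 1)) x"
      using n1 C(1-3) by (simp add: add.assoc)
    finally show "sigma_poly n \<theta> (C u v w) x = u * x + v * \<theta> x + w * (\<theta> ^^ (n - 1)) x" .
  qed
  have pow_n: "\<theta> ((\<theta> ^^ (n - 1)) x) = x" for x
    using fun_cong[OF \<theta>(2), of x] n by (cases n) auto
  have key: "\<exists>u w. \<forall>i<n. c i * (\<theta> ^^ i) \<alpha> = C u (w * \<eta>) w i" for \<alpha>
  proof -
    have "(\<lambda>x. \<alpha> * \<theta> x) \<in> twisted_Gabidulin_2 \<eta> \<theta>"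
      unfolding twisted_Gabidulin_2_def by (rule CollectI, rule exI[of _ 0], rule exI[of _ \<alpha>]) simp
    from H[OF this] obtain w u
      where wu: "\<And>x. \<phi> (\<alpha> * \<theta> x) = w * x + u * \<theta> x + w * \<eta> * (\<theta> ^^ 2) x"
      unfolding twisted_Gabidulin_2_def by (auto simp: fun_eq_iff)
    \<comment> \<open>Substitute the preimage of \<open>y\<close> under \<open>\<theta>\<close>; the
      power \<open>n - 1\<close> of \<open>\<theta>\<close> is its inverse.\<close>
    have "\<phi> (\<alpha> * y) = u * y + w * \<eta> * \<theta> y + w * (\<theta> ^^ (n - 1)) y" for y
      using wu[of "(\<theta> ^^ (n - 1)) y"] by (simp only: pow_n numeral_2_eq_2 funpow.simps o_apply id_apply) (simp add: ac_simps)
    moreover have "\<phi> (\<alpha> * y) = sigma_poly n \<theta> (\<lambda>i. c i * (\<theta> ^^ i) \<alpha>) y" for y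
      by (simp add: c sigma_poly_def field_Aut_mult[OF funpow_field_Aut[OF \<theta>(1)]] mult.assoc)
    ultimately have "sigma_poly n \<theta> (\<lambda>i. c i * (\<theta> ^^ i) \<alpha>) = sigma_poly n \<theta> (C u (w * \<eta>) w)"
      unfolding sparse by (simp add: fun_eq_iff)
    from sigma_poly_coeff_unique[OF \<theta>(1) inj this] show ?thesis by blast
  qed
  have mid: "c i = 0" if i: "i \<noteq> 0" "i \<noteq> 1" "i \<noteq> n - 1" "i < n" for i
  proof -
    obtain u w where "c i * (\<theta> ^^ i) 1 = C u (w * \<eta>) w i" using key[of 1] i(4) by blast
    then show ?thesis using C(4)[OF i(1-3)] field_Aut_1[OF funpow_field_Aut[OF \<theta>(1)]] by simp
  qed
  \<comment> \<open>Both outer coefficients are governed by the same \<open>w\<close>; eliminating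
    it leaves a relation valid for all \<open>\<alpha>\<close>.\<close>
  have "c 1 * \<theta> \<alpha> = \<eta> * c (n - 1) * (\<theta> ^^ (n - 1)) \<alpha>" for \<alpha>
  proof -
    obtain u w where uw: "\<And>i. i < n \<Longrightarrow> c i * (\<theta> ^^ i) \<alpha> = C u (w * \<eta>) w i"
      using key[of \<alpha>] by blast
    have "c 1 * \<theta> \<alpha> = w * \<eta>" using uw[of 1] n by (simp add: C(2)[simplified])
    moreover have "c (n - 1) * (\<theta> ^^ (n - 1)) \<alpha> = w" using uw[of "n - 1"] n by (simp only: C(3))
    ultimately show ?thesis by (simp add: mult.commute mult.left_commute)
  qed
  then have "sigma_poly n \<theta> (C 0 (c 1) 0) = sigma_poly n \<theta> (C 0 0 (\<eta> * c (n - 1)))"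
    unfolding sparse by (intro ext) (simp only: mult_zero_left add_0_left add_0_right)
  note uniq = sigma_poly_coeff_unique[OF \<theta>(1) inj this]
  have c1: "c 1 = 0" using uniq[of 1] n by (simp only: C)
  have \<eta>c: "\<eta> * c (n - 1) = 0" using uniq[of "n - 1"] n by (simp only: C)
  have "c i = C (c 0) 0 (c (n - 1)) i" if "i < n" for i
    using mid[OF _ _ _ that] c1 by (cases "i = 0 \<or> i = 1 \<or> i = n - 1") (auto simp: C_def)
  then have "\<phi> = sigma_poly n \<theta> (C (c 0) 0 (c (n - 1)))"
    unfolding c sigma_poly_def by (intro ext sum.cong refl) (metis lessThan_iff)
  then have \<phi>_eq: "\<phi> x = c 0 * x + c (n - 1) * (\<theta> ^^ (n - 1)) x" for x
    unfolding sparse by simp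
  have "c (n - 1) = 0"
  proof (rule ccontr)
    assume "c (n - 1) \<noteq> 0"
    with \<eta>c have \<eta>: "\<eta> = 0" by simp
    \<comment> \<open>For \<open>\<eta> = 0\<close> the identity is a codeword, hence so is
      \<open>\<phi>\<close> itself, which excludes the exponent -1.\<close>
    have "(\<lambda>x. x) \<in> twisted_Gabidulin_2 \<eta> \<theta>"
      unfolding twisted_Gabidulin_2_def \<eta> by (rule CollectI, rule exI[of _ 1], rule exI[of _ 0]) simp
    from H[OF this] obtain w u where "\<And>x. \<phi> x = w * x + u * \<theta> x"
      unfolding twisted_Gabidulin_2_def \<eta> by (auto simp: fun_eq_iff)
    then have "sigma_poly n \<theta> c = sigma_poly n \<theta> (C w u 0)"
      unfolding sparse c[symmetric] by (intro ext) simp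
    from sigma_poly_coeff_unique[OF \<theta>(1) inj this, of "n - 1"] n \<open>c (n - 1) \<noteq> 0\<close> show False
      by (simp add: C(3)[simplified])
  qed
  with \<phi>_eq show ?thesis by auto
qed

section \<open>Arithmetic of the exponents modulo \<open>t\<close> and \<open>2 * t\<close>\<close>

context
  fixes s t :: int
  assumes t: "t \<ge> 5" and cop: "coprime s (2 * t)"
begin

lemma not_dvd_double_of_coprime_double: "\<not> t dvd 2 * s"
proof
  assume "t dvd 2 * s"
  moreover have "coprime t s" using cop by (simp add: ac_simps)
  ultimately have "t dvd 2" by (simp add: coprime_dvd_mult_left_iff)
  then show False using zdvd_imp_le[of t 2] t by simp
qed

lemma not_dvd_of_coprime_double: "\<not> t dvd s"
  using not_dvd_double_of_coprime_double dvd_mult by blast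

text \<open>The four exponents of \<open>psi\<close> lie in the classes of \<open>\<plusminus>1\<close> modulo \<open>t\<close>. If two of
  them, \<open>j\<close> and \<open>j'\<close>, satisfy \<open>j - j' = s\<close> or \<open>j - j' = 2 * s\<close>, then one of these divisibilities holds for
  the class \<open>\<epsilon>\<close> of \<open>j\<close>.\<close>

lemma overlap_one_sided: "\<exists>\<epsilon>\<in>{1, -1}. \<not> t dvd s - 2 * \<epsilon> \<and> \<not> t dvd 2 * s - 2 * \<epsilon>"
proof (rule ccontr)
  assume "\<not> ?thesis"
  then have pos: "t dvd s - 2 \<or> t dvd 2 * s - 2" and neg: "t dvd s + 2 \<or> t dvd 2 * s + 2"
    by auto
  have four: "\<not> t dvd 4" using zdvd_imp_le[of t 4] t by auto
  have six: "t \<noteq> 6 \<or> odd s" using cop by auto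
  have six': "t = 6" if "t dvd 6" using that t zdvd_imp_le[of t 6] by (cases "t = 5") auto
  \<comment> \<open>Eliminating \<open>s\<close> gives \<open>t dvd 4\<close> in the two matching
    cases and \<open>t dvd 6\<close> in the two mixed ones. The latter forces \<open>t = 6\<close>
    with \<open>s\<close> even, against coprimality.\<close>
  from pos neg show False
  proof (elim disjE)
    assume "t dvd s - 2" "t dvd s + 2"
    then have "t dvd (s + 2) - (s - 2)" by (rule dvd_diff[rotated])
    with four show False by simp
  next
    assume *: "t dvd s - 2" "t dvd 2 * s + 2"
    then have "t dvd (2 * s + 2) - 2 * (s - 2)" by (metis dvd_diff dvd_mult)
    then have "t = 6" by (intro six') simp
    moreover from this * have "6 dvd s - 2" by simp
    ultimately show False using six by presburger
  next
    assume *: "t dvd 2 * s - 2" "t dvd s + 2"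
    then have "t dvd 2 * (s + 2) - (2 * s - 2)" by (metis dvd_diff dvd_mult)
    then have "t = 6" by (intro six') simp
    moreover from this * have "6 dvd s + 2" by simp
    ultimately show False using six by presburger
  next
    assume "t dvd 2 * s - 2" "t dvd 2 * s + 2"
    then have "t dvd (2 * s + 2) - (2 * s - 2)" by (rule dvd_diff[rotated])
    with four show False by simp
  qed
qed

end

definition psi_exponents :: "nat \<Rightarrow> nat set" where
  "psi_exponents t = {1, t - 1, t + 1, 2 * t - 1}"

lemma psi_exponents_cong:
  assumes "j \<in> psi_exponents t" "t \<ge> 1"
  obtains \<epsilon> where "\<epsilon> \<in> {1, -1}" "int t dvd int j - \<epsilon>"
proof -
  have "int (t - 1) = int t - 1" "int (2 * t - 1) = 2 * int t - 1" using assms(2) by auto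
  with assms(1) that[of 1] that[of "-1"] show thesis by (auto simp: psi_exponents_def)
qed

lemma psi_exponents_inj:
  assumes "t \<ge> 5" "j \<in> psi_exponents t" "j' \<in> psi_exponents t" "[j = j'] (mod 2 * t)"
  shows "j = j'"
  using assms by (auto simp: psi_exponents_def cong_def)

text \<open>Used when the exponent-0 coefficient of \<open>f\<close> is nonzero: some term of the
  composite is then not cancelled. The index \<open>j' = 0\<close> stands for the exponents
  \<open>i' * s\<close> allowed in a codeword. In a class modulo \<open>t\<close> without overlaps,
  both exponents would have to be such multiples of \<open>s\<close>; but they differ by
  \<open>t\<close>, and \<open>t\<close> does not divide \<open>s\<close>.\<close>

lemma psi_exponents_isolated:
  fixes s t :: nat
  assumes t: "t \<ge> 5" and cop: "coprime s (2 * t)"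
  shows "\<exists>j\<in>psi_exponents t. \<forall>j'\<in>insert 0 (psi_exponents t). \<forall>i'<3.
    [j' + i' * s = j] (mod 2 * t) \<longrightarrow> j' = j \<and> i' = 0"
proof (rule ccontr)
  assume contr: "\<not> ?thesis"
  have t': "int t \<ge> 5" and cop': "coprime (int s) (2 * int t)"
    using t cop by (simp, metis coprime_int_iff of_nat_mult of_nat_numeral)
  obtain \<epsilon> where \<epsilon>: "\<epsilon> \<in> {1, -1::int}"
    and ov: "\<not> int t dvd int s - 2 * \<epsilon>" "\<not> int t dvd 2 * int s - 2 * \<epsilon>"
    using overlap_one_sided[OF t' cop'] by blast
  have small: "\<not> int t dvd x" if "x \<noteq> 0" "\<bar>x\<bar> \<le> 4" for x
    using that t' dvd_imp_le_int[of x "int t"] by auto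
  have target: "\<exists>i\<in>{1, 2}. 2 * int t dvd i * int s - int j"
    if j: "j \<in> psi_exponents t" "int t dvd int j - \<epsilon>" for j
  proof -
    from contr j(1) obtain j' i' where *: "j' \<in> insert 0 (psi_exponents t)" "i' < 3"
      "[j' + i' * s = j] (mod 2 * t)" "\<not> (j' = j \<and> i' = 0)" by blast
    have d: "2 * int t dvd int j' + int i' * int s - int j"
      using *(3) by (metis cong_iff_dvd_diff cong_int_iff of_nat_add of_nat_mult of_nat_numeral)
    then have "int t dvd int j' + int i' * int s - int j" by (rule dvd_mult_right)
    then have dt: "int t dvd int j' + int i' * int s - \<epsilon>"
      using j(2) by (metis (no_types, opaque_lifting) diff_add_cancel add_diff_eq dvd_add)
    have i': "i' \<in> {0, 1, 2}" using *(2) by auto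
    show ?thesis
    proof (cases "j' = 0")
      case True
      have "\<not> int t dvd - \<epsilon>" using \<epsilon> by (intro small) auto
      with dt True have "i' \<noteq> 0" by (intro notI) simp
      with i' d True show ?thesis by auto
    next
      case False
      then have j': "j' \<in> psi_exponents t" using *(1) by simp
      then obtain \<epsilon>' where \<epsilon>': "\<epsilon>' \<in> {1, -1}" "int t dvd int j' - \<epsilon>'"
        using psi_exponents_cong t by (metis le_trans one_le_numeral)
      have "int t dvd (int j' + int i' * int s - \<epsilon>) - (int j' - \<epsilon>')"
        using dt \<epsilon>'(2) by (rule dvd_diff)
      then have e: "int t dvd int i' * int s + \<epsilon>' - \<epsilon>" by (simp add: algebra_simps)
      \<comment> \<open>Equal classes force \<open>i' = 0\<close> and then \<open>j' = j\<close>;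
        opposite classes are excluded by the choice of \<open>\<epsilon>\<close>, or for
        \<open>i' = 0\<close> by the size of \<open>t\<close>.\<close>
      have "\<epsilon>' = \<epsilon> \<or> \<epsilon>' = - \<epsilon>" using \<epsilon> \<epsilon>'(1) by auto
      then have False
      proof
        assume "\<epsilon>' = \<epsilon>"
        with e have "int t dvd int i' * int s" by simp
        with i' not_dvd_of_coprime_double[OF t' cop'] not_dvd_double_of_coprime_double[OF t' cop'] have "i' = 0" by auto
        with *(3) psi_exponents_inj[OF t j' j(1)] *(4) show False by simp
      next
        assume "\<epsilon>' = - \<epsilon>"
        with e have "int t dvd int i' * int s - 2 * \<epsilon>" by simp
        with i' ov small[of "2 * \<epsilon>"] \<epsilon> show False by auto
      qed
      then show ?thesis ..
    qed
  qed
  \<comment> \<open>The class of \<open>\<epsilon>\<close> holds exactly two exponents,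
    \<open>1\<close> and \<open>t + 1\<close> or \<open>t - 1\<close> and
    \<open>2 * t - 1\<close>.\<close>
  obtain j j' where j: "j \<in> psi_exponents t" "int t dvd int j - \<epsilon>"
    and j': "j' \<in> psi_exponents t" "int t dvd int j' - \<epsilon>" and jj': "int j' = int j + int t"
  proof (cases "\<epsilon> = 1")
    case True
    with that[of 1 "t + 1"] show thesis by (simp add: psi_exponents_def)
  next
    case False
    with \<epsilon> have "\<epsilon> = -1" by simp
    with that[of "t - 1" "2 * t - 1"] t show thesis by (simp add: psi_exponents_def of_nat_diff)
  qed
  obtain i i' where i: "i \<in> {1, 2}" "2 * int t dvd i * int s - int j"
    and i': "i' \<in> {1, 2}" "2 * int t dvd i' * int s - int j'"
    using target[OF j] target[OF j'] by blast
  have "2 * int t dvd (i' * int s - int j') - (i * int s - int j)" using i'(2) i(2) by (rule dvd_diff)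
  then have e: "2 * int t dvd (i' - i) * int s - int t" by (simp add: jj' algebra_simps)
  then have "int t dvd (i' - i) * int s - int t" by (rule dvd_mult_right)
  then have "int t dvd (i' - i) * int s" by (metis diff_add_cancel dvd_add dvd_refl)
  with i(1) i'(1) not_dvd_of_coprime_double[OF t' cop'] have "i' = i" by auto
  with e have "2 * int t dvd int t" by simp
  with t show False by (auto dest: zdvd_imp_le)
qed

text \<open>The counterpart for \<open>f\<close> a multiple of \<open>\<theta>\<close>. Otherwise
  \<open>1\<close> and \<open>t + 1\<close> would both be congruent to \<open>s\<close> or
  \<open>-s\<close> modulo \<open>2 * t\<close>, so that their difference \<open>t\<close> would be
  congruent to \<open>0\<close> or to plus or minus \<open>2 * s\<close>.\<close>

lemma psi_exponents_shift_isolated: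
  fixes s t :: nat
  assumes t: "t \<ge> 5" and cop: "coprime s (2 * t)"
  shows "\<exists>j\<in>psi_exponents t. \<forall>i'<3. \<not> [i' * s = j + s] (mod 2 * t)"
proof (rule ccontr)
  assume contr: "\<not> ?thesis"
  have t': "int t \<ge> 5" and cop': "coprime (int s) (2 * int t)"
    using t cop by (simp, metis coprime_int_iff of_nat_mult of_nat_numeral)
  have ex: "\<exists>i\<in>{-1, 1}. 2 * int t dvd i * int s - int j" if j: "j \<in> psi_exponents t" for j
  proof -
    from contr j obtain i' where i': "i' < 3" "[i' * s = j + s] (mod 2 * t)" by blast
    then have d: "2 * int t dvd (int i' - 1) * int s - int j"
      by (metis (no_types, opaque_lifting) cong_iff_dvd_diff cong_int_iff of_nat_add of_nat_mult of_nat_numeral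
          diff_diff_eq diff_diff_eq2 left_diff_distrib mult_1 add.commute)
    have "i' \<noteq> 1"
    proof
      assume "i' = 1"
      with d have "int (2 * t) dvd int j" by simp
      then have "2 * t dvd j" by (simp only: int_dvd_int_iff)
      with j t show False by (auto simp: psi_exponents_def dest: dvd_imp_le)
    qed
    with i'(1) have "i' = 0 \<or> i' = 2" by auto
    with d show ?thesis by auto
  qed
  have "1 \<in> psi_exponents t" "t + 1 \<in> psi_exponents t" by (simp_all add: psi_exponents_def)
  from ex[OF this(1)] ex[OF this(2)]
  obtain i i' where i: "i \<in> {-1, 1}" "2 * int t dvd i * int s - 1"
    and i': "i' \<in> {-1, 1}" "2 * int t dvd i' * int s - (1 + int t)"
    unfolding of_nat_add of_nat_1 add.commute[of "int t"] by blast
  have "2 * int t dvd (i' * int s - (1 + int t)) - (i * int s - 1)" using i'(2) i(2) by (rule dvd_diff)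
  then have e: "2 * int t dvd (i' - i) * int s - int t" by (simp add: algebra_simps)
  then have "int t dvd (i' - i) * int s - int t" by (rule dvd_mult_right)
  then have "int t dvd (i' - i) * int s" by (metis diff_add_cancel dvd_add dvd_refl)
  with i(1) i'(1) not_dvd_double_of_coprime_double[OF t' cop'] have "i' = i" by auto
  with e have "2 * int t dvd int t" by simp
  with t show False by (auto dest: zdvd_imp_le)
qed

section \<open>Semilinearity and coefficient descriptions\<close>

text \<open>Normalise \<open>f\<close> by \<open>f 1\<close>. Taking \<open>x = 1\<close> in the
  scaling hypothesis identifies the multiplier with the normalised value at \<open>\<alpha>\<close>,
  which makes the normalised map multiplicative.\<close>

lemma semilinear_of_left_conjugation:
  assumes f: "bij f" "f 0 = 0" "\<And>x y. f (x + y) = f x + f (y::'a::field)"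
    and scale: "\<And>\<alpha>. \<exists>b. \<forall>x. f (\<alpha> * x) = b * f x"
    and K: "\<And>\<alpha>. \<alpha> \<in> K \<Longrightarrow> f \<alpha> = \<alpha> * f 1"
  obtains \<tau> b where "\<tau> \<in> Gal K" "b \<noteq> 0" "\<And>x. f x = b * \<tau> x"
proof
  define b where "b = f 1"
  define \<tau> where "\<tau> x = f x / b" for x
  have "f 1 \<noteq> f 0" using f(1) by (metis bij_pointE zero_neq_one)
  then show b: "b \<noteq> 0" by (simp add: b_def f(2))
  show f_eq: "f x = b * \<tau> x" for x using b by (simp add: \<tau>_def)
  have "f (\<alpha> * x) = \<tau> \<alpha> * f x" for \<alpha> x
  proof -
    obtain c where c: "\<And>x. f (\<alpha> * x) = c * f x" using scale by blast
    from c[of 1] b have "c = \<tau> \<alpha>" by (simp add: \<tau>_def b_def)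
    with c show ?thesis by simp
  qed
  then have mult: "\<tau> (\<alpha> * x) = \<tau> \<alpha> * \<tau> x" for \<alpha> x by (simp add: \<tau>_def)
  have "bij (\<lambda>x. x / b)"
    using b by (intro bij_betw_byWitness[where f' = "\<lambda>x. x * b"]) auto
  from bij_comp[OF f(1) this] have "bij \<tau>" by (simp add: \<tau>_def[abs_def] o_def)
  with mult b show "\<tau> \<in> Gal K"
    by (auto simp: Gal_def field_Aut_def \<tau>_def f(3) add_divide_distrib b_def K)
qed

lemma psi_eq_sum:
  assumes "t \<ge> 5" "\<sigma> \<in> field_Aut" "h \<noteq> 0"
  obtains d where "\<And>j. j \<in> psi_exponents t \<Longrightarrow> d j \<noteq> 0" "\<And>j. j \<notin> psi_exponents t \<Longrightarrow> d j = 0"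
    "psi h t \<sigma> = sigma_poly (2 * t) \<sigma> d"
proof -
  define d where "d j = (if j = 1 then 1 else if j = t - 1 then 1 else if j = t + 1 then h * \<sigma> h
    else if j = 2 * t - 1 then h * inv_into UNIV \<sigma> (inverse h) else 0)" for j
  have "\<sigma> (inv_into UNIV \<sigma> (inverse h)) = inverse h"
    using field_Aut_bij[OF assms(2)] by (simp add: bij_is_surj surj_f_inv_f)
  then have "inv_into UNIV \<sigma> (inverse h) \<noteq> 0"
    using assms(3) field_Aut_0[OF assms(2)] by force
  then have 1: "d j \<noteq> 0" if "j \<in> psi_exponents t" for j
    using that assms field_Aut_eq_0_iff[OF assms(2), of h] by (auto simp: d_def psi_exponents_def)
  have 2: "d j = 0" if "j \<notin> psi_exponents t" for j
    using that by (simp add: d_def psi_exponents_def)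
  have neq: "1 \<noteq> t - 1" "1 \<noteq> t + 1" "1 \<noteq> 2 * t - 1" "t - 1 \<noteq> t + 1" "t - 1 \<noteq> 2 * t - 1" "t + 1 \<noteq> 2 * t - 1"
    using assms(1) by auto
  have "sigma_poly (2 * t) \<sigma> d x = psi h t \<sigma> x" for x
  proof -
    have "sigma_poly (2 * t) \<sigma> d x = (\<Sum>j\<in>psi_exponents t. d j * (\<sigma> ^^ j) x)"
      unfolding sigma_poly_def using assms(1) 2
      by (intro sum.mono_neutral_right) (auto simp: psi_exponents_def)
    also have "\<dots> = d 1 * (\<sigma> ^^ 1) x + (d (t - 1) * (\<sigma> ^^ (t - 1)) x
        + (d (t + 1) * (\<sigma> ^^ (t + 1)) x + d (2 * t - 1) * (\<sigma> ^^ (2 * t - 1)) x))"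
      unfolding psi_exponents_def using neq by simp
    also have "\<dots> = psi h t \<sigma> x"
      unfolding d_def psi_def using neq by (simp add: add.assoc)
    finally show ?thesis .
  qed
  with that[of d] 1 2 show thesis by (simp add: fun_eq_iff)
qed

text \<open>Left linearity of the code, phrased on coefficients because \<open>\<rho>\<close> acts
  on coefficients in an equivalence.\<close>

lemma code_C_sigma_poly_iff_scale:
  assumes "\<beta> \<noteq> 0"
  shows "sigma_poly n \<sigma> (\<lambda>i. \<beta> * a i) \<in> code_C h t \<sigma>
    \<longleftrightarrow> sigma_poly n \<sigma> a \<in> code_C h t \<sigma>"
proof -
  have "sigma_poly n \<sigma> (\<lambda>i. \<beta> * a i) = (\<lambda>x. \<beta> * sigma_poly n \<sigma> a x)" for \<beta> and a
    by (simp add: sigma_poly_def sum_distrib_left mult.assoc)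
  then show ?thesis
    using left_scalar.span_scale[of "sigma_poly n \<sigma> a" _ \<beta>]
      left_scalar.span_scale[of "\<lambda>x. \<beta> * sigma_poly n \<sigma> a x" _ "inverse \<beta>"] assms
    by (auto simp: code_C_def mult.assoc[symmetric])
qed

lemma Gal_generator_funpow_eqD:
  fixes K :: "'a::{field,finite} set"
  assumes "primepow q" "is_subfield K" "card K = q" "CARD('a) = q ^ n" "n > 0"
    and \<sigma>: "Gal_generator K \<sigma>" and eq: "\<sigma> ^^ i = \<sigma> ^^ j"
  shows "[i = j] (mod n)"
  using eq
proof (induction i j rule: linorder_wlog)
  case (le i j)
  have "bij (\<sigma> ^^ i)"
    using \<sigma> by (intro bij_fn field_Aut_bij) (simp add: Gal_generator_def Gal_def)
  moreover have "\<sigma> ^^ (j - i) \<circ> \<sigma> ^^ i = id \<circ> \<sigma> ^^ i"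
    unfolding funpow_add[symmetric] using le by simp
  ultimately have "\<sigma> ^^ (j - i) = id"
    by (metis bij_betw_def o_id surj_iff comp_assoc)
  then have "n dvd j - i" using Gal_generator_funpow_eq_idD[OF assms(1-6)] by blast
  then show ?case using le by (metis cong_altdef_nat cong_sym)
qed (simp add: cong_sym)

text \<open>Let \<open>w i\<close> be the coefficients of \<open>f\<close>. If \<open>w 0\<close> is
  nonzero, an isolated exponent \<open>j\<close> gives an uncancelled term. Otherwise
  \<open>w 2 = w 0 * \<eta>\<close> vanishes too, \<open>f\<close> is a nonzero multiple of
  \<open>\<theta>\<close>, and the shifted isolation applies.\<close>

lemma psi_comp_not_in_twisted_Gabidulin:
  fixes \<sigma> :: "'a::field \<Rightarrow> 'a"
  assumes \<sigma>: "\<sigma> \<in> field_Aut" and t: "t \<ge> 5"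
    and ord: "\<And>i j. \<sigma> ^^ i = \<sigma> ^^ j \<Longrightarrow> [i = j] (mod 2 * t)"
    and cop: "coprime s (2 * t)"
    and d: "\<And>j. j \<in> psi_exponents t \<Longrightarrow> d j \<noteq> 0"
    and f: "f \<in> twisted_Gabidulin_2 \<eta> (\<sigma> ^^ s)" "\<exists>x. f x \<noteq> 0"
  shows "(\<lambda>x. \<Sum>j\<in>psi_exponents t. d j * (\<sigma> ^^ j) (f x)) \<notin> twisted_Gabidulin_2 \<eta> (\<sigma> ^^ s)"
proof
  let ?J = "psi_exponents t"
  assume g: "(\<lambda>x. \<Sum>j\<in>?J. d j * (\<sigma> ^^ j) (f x)) \<in> twisted_Gabidulin_2 \<eta> (\<sigma> ^^ s)"
  have J: "finite ?J" "0 \<notin> ?J" using t by (auto simp: psi_exponents_def)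
  have expand: "\<exists>w. (\<forall>x. f x = (\<Sum>i<3. w i * (\<sigma> ^^ (i * s)) x)) \<and> w 2 = w 0 * \<eta>"
    if f: "f \<in> twisted_Gabidulin_2 \<eta> (\<sigma> ^^ s)" for f
  proof -
    obtain a0 a1 where "\<And>x. f x = a0 * x + a1 * (\<sigma> ^^ s) x + a0 * \<eta> * ((\<sigma> ^^ s) ^^ 2) x"
      using f by (auto simp: twisted_Gabidulin_2_def)
    then show ?thesis
      by (intro exI[of _ "\<lambda>i. if i = 0 then a0 else if i = 1 then a1 else a0 * \<eta>"])
        (simp add: eval_nat_numeral funpow_mult funpow_add)
  qed
  obtain w where w: "\<And>x. f x = (\<Sum>i<3. w i * (\<sigma> ^^ (i * s)) x)" "w 2 = w 0 * \<eta>"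
    using expand[OF f(1)] by blast
  obtain v where v: "\<And>x. (\<Sum>j\<in>?J. d j * (\<sigma> ^^ j) (f x)) = (\<Sum>i<3. v i * (\<sigma> ^^ (i * s)) x)"
    using expand[OF g] by blast
  \<comment> \<open>The pairs with first component \<open>0\<close>, which is not an exponent of \<open>psi\<close>, encode the right-hand side.\<close>
  define D where "D = (\<lambda>(j, i). if j = 0 then - v i else d j * (\<sigma> ^^ j) (w i))"
  have D0: "D (j, i) = 0 \<longleftrightarrow> w i = 0" if "j \<in> ?J" for i j
    using that J d by (auto simp: D_def field_Aut_eq_0_iff[OF funpow_field_Aut[OF \<sigma>]])
  have sum0: "(\<Sum>a\<in>insert 0 ?J \<times> {..<3}. D a * (\<sigma> ^^ (case a of (j, i) \<Rightarrow> j + i * s)) x) = 0" for x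
  proof -
    have "(\<Sum>a\<in>insert 0 ?J \<times> {..<3}. D a * (\<sigma> ^^ (case a of (j, i) \<Rightarrow> j + i * s)) x)
        = (\<Sum>j\<in>insert 0 ?J. \<Sum>i<3. D (j, i) * (\<sigma> ^^ (j + i * s)) x)"
      by (subst sum.cartesian_product) (simp add: case_prod_unfold)
    also have "\<dots> = (\<Sum>i<3. D (0, i) * (\<sigma> ^^ (i * s)) x)
        + (\<Sum>j\<in>?J. \<Sum>i<3. D (j, i) * (\<sigma> ^^ (j + i * s)) x)"
      using J by simp
    also have "(\<Sum>i<3. D (0, i) * (\<sigma> ^^ (i * s)) x) = - (\<Sum>i<3. v i * (\<sigma> ^^ (i * s)) x)"
      by (simp add: D_def sum_negf)
    also have "(\<Sum>j\<in>?J. \<Sum>i<3. D (j, i) * (\<sigma> ^^ (j + i * s)) x) = (\<Sum>j\<in>?J. d j * (\<sigma> ^^ j) (f x))"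
    proof (rule sum.cong[OF refl])
      fix j assume "j \<in> ?J"
      then have "j \<noteq> 0" using J by metis
      then show "(\<Sum>i<3. D (j, i) * (\<sigma> ^^ (j + i * s)) x) = d j * (\<sigma> ^^ j) (f x)"
        by (simp add: D_def w(1) field_Aut_sum funpow_field_Aut[OF \<sigma>] field_Aut_mult
            sum_distrib_left funpow_add mult.assoc)
    qed
    finally show ?thesis by (simp add: v)
  qed
  have collision: "\<exists>j'\<in>insert 0 ?J. \<exists>i'<3. (j', i') \<noteq> (j, i) \<and> [j' + i' * s = j + i * s] (mod 2 * t)
      \<and> D (j', i') \<noteq> 0"
    if ji: "j \<in> ?J" "i < 3" "w i \<noteq> 0" for j i
  proof -
    obtain a where "a \<in> insert 0 ?J \<times> {..<3}" "a \<noteq> (j, i)"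
      "\<sigma> ^^ (case a of (j, i) \<Rightarrow> j + i * s) = \<sigma> ^^ (case (j, i) of (j, i) \<Rightarrow> j + i * s)" "D a \<noteq> 0"
      using field_Aut_sum_eq_0_collision[where A = "insert 0 ?J \<times> {..<3}" and ?a0.0 = "(j, i)"
          and T = "\<lambda>a. \<sigma> ^^ (case a of (j, i) \<Rightarrow> j + i * s)" and d = D, OF _ _ sum0]
        J ji funpow_field_Aut[OF \<sigma>] D0 by blast
    then show ?thesis using ord by (cases a) force
  qed
  show False
  proof (cases "w 0 = 0")
    case False
    obtain j where j: "j \<in> ?J" "\<And>j' i'. j' \<in> insert 0 ?J \<Longrightarrow> i' < 3 \<Longrightarrow> [j' + i' * s = j] (mod 2 * t)
        \<Longrightarrow> j' = j \<and> i' = 0"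
      using psi_exponents_isolated[OF t cop] by blast
    obtain j' i' where "j' \<in> insert 0 ?J" "i' < 3" "(j', i') \<noteq> (j, 0)" "[j' + i' * s = j + 0 * s] (mod 2 * t)"
      using collision[OF j(1) zero_less_numeral False] by blast
    with j(2)[of j' i'] show False by simp
  next
    case True
    have "w 1 \<noteq> 0"
    proof
      assume "w 1 = 0"
      with True w have "f x = 0" for x by (simp add: eval_nat_numeral)
      with f(2) show False by simp
    qed
    obtain j where j: "j \<in> ?J" "\<And>i'. i' < 3 \<Longrightarrow> \<not> [i' * s = j + s] (mod 2 * t)"
      using psi_exponents_shift_isolated[OF t cop] by blast
    have "(1::nat) < 3" by simp
    from collision[OF j(1) this \<open>w 1 \<noteq> 0\<close>]
    obtain j' i' where *: "j' \<in> insert 0 ?J" "i' < 3" "(j', i') \<noteq> (j, 1)"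
      "[j' + i' * s = j + 1 * s] (mod 2 * t)" "D (j', i') \<noteq> 0" by blast
    \<comment> \<open>The choice of \<open>j\<close> rules out a partner with first component
      \<open>0\<close>. Only \<open>w 1\<close> is nonzero, so the partner has
      \<open>i' = 1\<close>, and cancelling \<open>s\<close> gives \<open>j' = j\<close>.\<close>
    have j': "j' \<in> ?J" using * j(2)[of i'] by auto
    have "w i' \<noteq> 0" using D0[OF j', of i'] *(5) by simp
    moreover have "i' = 0 \<or> i' = 1 \<or> i' = 2" using *(2) by auto
    ultimately have "i' = 1" using True w(2) by auto
    with * psi_exponents_inj[OF t j' j(1)] show False
      by (simp add: cong_add_rcancel_nat)
  qed
qed

section \<open>From an equivalence to two codewords that cannot coexist\<close>

theorem theorem4p3:
  fixes K :: "'a::{field,finite} set"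
    and q n t :: nat
    and \<sigma> \<theta> :: "'a \<Rightarrow> 'a"
    and h \<eta> :: 'a
  assumes "primepow q" and "odd q"
    and "n = 2 * t" and "t \<ge> 5"
    and "is_subfield K" and "card K = q" and "CARD('a) = q ^ n"
    and "Gal_generator K \<sigma>" and "Gal_generator K \<theta>"
    and "(\<sigma> ^^ t) h * h = - 1"
    and "field_norm K \<eta> \<noteq> 1"
  shows "\<not> code_equivalent n \<sigma> (twisted_Gabidulin_2 \<eta> \<theta>) (code_C h t \<sigma>)"
proof
  assume "code_equivalent n \<sigma> (twisted_Gabidulin_2 \<eta> \<theta>) (code_C h t \<sigma>)"
  then obtain f1 f2 \<rho> where f1: "f1 \<in> invertible_sigma_polys n \<sigma>"
    and f2: "f2 \<in> invertible_sigma_polys n \<sigma>" and \<rho>: "\<rho> \<in> field_Aut"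
    and H: "twisted_Gabidulin_2 \<eta> \<theta>
      = {f1 \<circ> sigma_poly n \<sigma> (\<rho> \<circ> a) \<circ> f2 | a. sigma_poly n \<sigma> a \<in> code_C h t \<sigma>}"
    unfolding code_equivalent_def by blast
  have n: "n > 0" "n > 2" using assms by auto
  note basic = assms(1,5,6,7) n(1)
  have \<sigma>G: "\<sigma> \<in> Gal K" and \<theta>G: "\<theta> \<in> Gal K"
    using assms(8,9) by (simp_all add: Gal_generator_def)
  have \<sigma>: "\<sigma> \<in> field_Aut" and \<theta>: "\<theta> \<in> field_Aut"
    using \<sigma>G \<theta>G by (simp_all add: Gal_imp_field_Aut)
  have \<sigma>n: "\<sigma> ^^ n = id" and \<theta>n: "\<theta> ^^ n = id"
    using Gal_generator_funpow_id[OF basic] assms(8,9) by blast+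
  note \<sigma>_eqD = Gal_generator_funpow_eqD[OF basic assms(8)]
  note \<theta>_eqD = Gal_generator_funpow_eqD[OF basic assms(9)]
  obtain s where s: "\<theta> = \<sigma> ^^ s" using assms(8) \<theta>G by (auto simp: Gal_generator_def)
  obtain r where r: "\<sigma> = \<theta> ^^ r" using assms(9) \<sigma>G by (auto simp: Gal_generator_def)
  \<comment> \<open>Each generator is a power of the other, so \<open>s\<close> is a unit modulo
    \<open>n\<close>.\<close>
  have "\<sigma> ^^ (s * r) = \<theta> ^^ r" by (simp add: s funpow_mult mult.commute)
  then have "\<sigma> ^^ (s * r) = \<sigma> ^^ 1" using r by simp
  then have "[s * r = 1] (mod n)" by (rule \<sigma>_eqD)
  then have cop: "coprime s (2 * t)"
    using assms(3) by (metis coprime_iff_invertible_nat One_nat_def)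
  have inj_\<theta>: "inj_on (\<lambda>i. \<theta> ^^ i) {..<n}"
    using \<theta>_eqD by (intro inj_onI) (metis cong_less_modulus_unique_nat lessThan_iff)
  obtain g1 where g1: "g1 \<in> sigma_polys n \<sigma>" "f1 \<circ> g1 = id" "g1 \<circ> f1 = id"
    using f1 by (auto simp: invertible_sigma_polys_def)
  have f1': "f1 \<in> sigma_polys n \<sigma>" using f1 by (simp add: invertible_sigma_polys_def)
  obtain c where c: "f1 = sigma_poly n \<sigma> c" using f1' by (auto simp: sigma_polys_def)
  have f1_0: "f1 0 = 0"
    by (simp add: c sigma_poly_def field_Aut_0 funpow_field_Aut[OF \<sigma>])
  have f1_add: "f1 (x + y) = f1 x + f1 y" for x y
    by (simp add: c sigma_poly_def field_Aut_add funpow_field_Aut[OF \<sigma>] distrib_left sum.distrib)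
  have f1_K: "f1 \<alpha> = \<alpha> * f1 1" if "\<alpha> \<in> K" for \<alpha>
    using that by (simp add: c sigma_poly_def field_Aut_1 funpow_field_Aut[OF \<sigma>]
        Gal_fixes[OF funpow_Gal[OF \<sigma>G]] sum_distrib_left mult.commute)
  have f1_bij: "bij f1" using g1 by (intro o_bij)
  have f1_semilinear: "\<exists>b. \<forall>x. f1 (\<alpha> * x) = b * f1 x" for \<alpha>
  proof (cases "\<alpha> = 0")
    case True
    then show ?thesis using f1_0 by (auto intro: exI[of _ 0])
  next
    case False
    \<comment> \<open>Scaling by \<open>\<alpha>\<close>, conjugated by \<open>f1\<close>, preserves
      the twisted Gabidulin code because \<open>code_C h t \<sigma>\<close> is closed under
      scalars.\<close>
    define \<phi> where "\<phi> = f1 \<circ> (\<lambda>x. \<alpha> * x) \<circ> g1"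
    have "\<phi> \<in> sigma_polys n \<sigma>"
      unfolding \<phi>_def using f1' g1(1) \<sigma> \<sigma>n n
      by (intro sigma_polys_comp scale_in_sigma_polys)
    then have "\<phi> \<in> sigma_polys n \<theta>"
      using sigma_polys_funpow_subset[OF \<theta>n n(1), of r] r by auto
    moreover have "\<phi> \<circ> g \<in> twisted_Gabidulin_2 \<eta> \<theta>" if "g \<in> twisted_Gabidulin_2 \<eta> \<theta>" for g
    proof -
      from that obtain a where a: "g = f1 \<circ> sigma_poly n \<sigma> (\<rho> \<circ> a) \<circ> f2"
        "sigma_poly n \<sigma> a \<in> code_C h t \<sigma>" unfolding H by blast
      \<comment> \<open>The scalar is pulled back along \<open>\<rho>\<close>, since coefficients of
        \<open>code_C h t \<sigma>\<close> enter only after applying \<open>\<rho>\<close>.\<close>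
      obtain \<beta> where \<beta>: "\<rho> \<beta> = \<alpha>" using field_Aut_bij[OF \<rho>] by (metis bij_pointE)
      with False have "\<beta> \<noteq> 0" using field_Aut_0[OF \<rho>] by auto
      then have "sigma_poly n \<sigma> (\<lambda>i. \<beta> * a i) \<in> code_C h t \<sigma>"
        using a(2) code_C_sigma_poly_iff_scale by blast
      moreover have "\<phi> \<circ> g = f1 \<circ> sigma_poly n \<sigma> (\<rho> \<circ> (\<lambda>i. \<beta> * a i)) \<circ> f2"
        using g1(3) by (simp add: \<phi>_def a(1) fun_eq_iff sigma_poly_def field_Aut_mult[OF \<rho>] \<beta>
            sum_distrib_left mult.assoc)
      ultimately show ?thesis unfolding H by blast
    qed
    ultimately obtain b where "\<And>x. \<phi> x = b * x"
      using sigma_polys_left_idealiser_twisted_Gabidulin[OF \<theta> \<theta>n inj_\<theta> n(2)] by blast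
    from this[of "f1 x" for x] show ?thesis
      using g1(3) by (auto simp: \<phi>_def fun_eq_iff)
  qed
  obtain \<tau> b where \<tau>G: "\<tau> \<in> Gal K" and b: "b \<noteq> 0" and \<tau>: "\<And>x. f1 x = b * \<tau> x"
    using semilinear_of_left_conjugation[OF f1_bij f1_0 f1_add f1_semilinear f1_K] by blast
  have \<tau>A: "\<tau> \<in> field_Aut" using \<tau>G by (rule Gal_imp_field_Aut)
  obtain k where k: "\<tau> = \<sigma> ^^ k" using assms(8) \<tau>G by (auto simp: Gal_generator_def)
  have comm: "\<tau> ((\<sigma> ^^ j) x) = (\<sigma> ^^ j) (\<tau> x)" for j x
    unfolding k by (metis add.commute comp_apply funpow_add)
  have h: "h \<noteq> 0" using assms(10) by auto
  obtain d where d: "\<And>j. j \<in> psi_exponents t \<Longrightarrow> d j \<noteq> 0" "\<And>j. j \<notin> psi_exponents t \<Longrightarrow> d j = 0"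
    "psi h t \<sigma> = sigma_poly (2 * t) \<sigma> d"
    using psi_eq_sum[OF assms(4) \<sigma> h] by blast
  \<comment> \<open>\<open>f\<close> is the codeword corresponding to the identity, whose
    coefficients \<open>e\<close> are fixed by \<open>\<rho>\<close>.\<close>
  define f where "f = f1 \<circ> f2"
  define e :: "nat \<Rightarrow> 'a" where "e i = (if i = 0 then 1 else 0)" for i
  have e: "sigma_poly n \<sigma> e = (\<lambda>x. x)"
  proof
    fix x
    have "(\<Sum>i<n. e i * (\<sigma> ^^ i) x) = (\<Sum>i\<in>{0}. e i * (\<sigma> ^^ i) x)"
      using n by (intro sum.mono_neutral_right) (auto simp: e_def)
    then show "sigma_poly n \<sigma> e x = x" by (simp add: sigma_poly_def e_def)
  qed
  have "(\<lambda>x. x) \<in> code_C h t \<sigma>"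
    unfolding code_C_def by (intro left_scalar.span_base) simp
  then have "f1 \<circ> sigma_poly n \<sigma> (\<rho> \<circ> e) \<circ> f2 \<in> twisted_Gabidulin_2 \<eta> \<theta>"
    unfolding H using e by (intro CollectI exI[of _ e]) simp
  moreover have "\<rho> \<circ> e = e"
    using field_Aut_0[OF \<rho>] field_Aut_1[OF \<rho>] by (auto simp: e_def)
  ultimately have "f1 \<circ> (\<lambda>x. x) \<circ> f2 \<in> twisted_Gabidulin_2 \<eta> \<theta>" using e by simp
  then have f_H: "f \<in> twisted_Gabidulin_2 \<eta> \<theta>" by (simp add: f_def o_def)
  have "bij f2" using f2 by (auto simp: invertible_sigma_polys_def intro: o_bij)
  with f1_bij have "bij f" by (simp add: f_def bij_comp)
  then have f_nz: "\<exists>x. f x \<noteq> 0" by (metis bij_pointE zero_neq_one)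
  \<comment> \<open>Since \<open>f1\<close> is \<open>b\<close> times \<open>\<tau>\<close> and
    \<open>\<tau>\<close> commutes with \<open>\<sigma>\<close>, the image of \<open>psi\<close> can
    be rewritten through \<open>f\<close>; the divisor undoes the factor that
    \<open>\<sigma> ^^ j\<close> produces from \<open>b\<close>.\<close>
  define D where "D j = \<tau> (\<rho> (d j)) * b / (\<sigma> ^^ j) b" for j
  have "psi h t \<sigma> \<in> code_C h t \<sigma>"
    unfolding code_C_def by (intro left_scalar.span_base) simp
  then have "f1 \<circ> sigma_poly n \<sigma> (\<rho> \<circ> d) \<circ> f2 \<in> twisted_Gabidulin_2 \<eta> \<theta>"
    unfolding H using d(3) assms(3) by (intro CollectI exI[of _ d]) simp
  also have "f1 \<circ> sigma_poly n \<sigma> (\<rho> \<circ> d) \<circ> f2 = (\<lambda>x. \<Sum>j\<in>psi_exponents t. D j * (\<sigma> ^^ j) (f x))"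
  proof
    fix x
    have "(f1 \<circ> sigma_poly n \<sigma> (\<rho> \<circ> d) \<circ> f2) x = (\<Sum>j<n. b * \<tau> (\<rho> (d j)) * (\<sigma> ^^ j) (\<tau> (f2 x)))"
      by (simp add: \<tau> sigma_poly_def field_Aut_sum[OF \<tau>A] field_Aut_mult[OF \<tau>A] comm
          sum_distrib_left mult.assoc)
    also have "\<dots> = (\<Sum>j<n. D j * (\<sigma> ^^ j) (f x))"
    proof (rule sum.cong[OF refl])
      fix j
      have "(\<sigma> ^^ j) b \<noteq> 0" using b funpow_field_Aut[OF \<sigma>] by (simp add: field_Aut_eq_0_iff)
      then show "b * \<tau> (\<rho> (d j)) * (\<sigma> ^^ j) (\<tau> (f2 x)) = D j * (\<sigma> ^^ j) (f x)"
        by (simp add: D_def f_def \<tau> field_Aut_mult funpow_field_Aut[OF \<sigma>])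
    qed
    also have "\<dots> = (\<Sum>j\<in>psi_exponents t. D j * (\<sigma> ^^ j) (f x))"
      using d(2) assms(3,4)
      by (intro sum.mono_neutral_right) (auto simp: D_def field_Aut_0[OF \<rho>] field_Aut_0[OF \<tau>A] psi_exponents_def)
    finally show "(f1 \<circ> sigma_poly n \<sigma> (\<rho> \<circ> d) \<circ> f2) x = (\<Sum>j\<in>psi_exponents t. D j * (\<sigma> ^^ j) (f x))" .
  qed
  finally have "(\<lambda>x. \<Sum>j\<in>psi_exponents t. D j * (\<sigma> ^^ j) (f x)) \<in> twisted_Gabidulin_2 \<eta> \<theta>" .
  moreover have "D j \<noteq> 0" if "j \<in> psi_exponents t" for j
    using d(1)[OF that] b
    by (simp add: D_def field_Aut_eq_0_iff[OF \<rho>] field_Aut_eq_0_iff[OF \<tau>A] field_Aut_eq_0_iff[OF funpow_field_Aut[OF \<sigma>]])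
  ultimately show False
    using psi_comp_not_in_twisted_Gabidulin[OF \<sigma> assms(4) \<sigma>_eqD[unfolded assms(3)] cop, of D f \<eta>]
      s f_H f_nz by simp
qed

end
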